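(* For every convex body $K\subset\mathbb{H}^n$, $n\ge2$, $$\mathrm{diam}\,K=\max\{w(K,H) : H\text{ is a hyperplane intersecting }K\}.$$
   Context: $\mathbb{H}^n$ is $n$-dimensional hyperbolic space with geodesic distance $d$. A convex body is a compact (geodesically) convex set with non-empty interior. Extended Leichtweiss width: for a hyperplane $H$ let $H^{(\varepsilon)}=\{x:d(x,H)\le\varepsilon\}$. For a hyperplane $H$ with $H\cap K\neq\emptyset$, bounding closed half-spaces $H^+,H^-$, the supporting hyperspherical domain is the closed set $\mathcal{A}\supset K$ bounded by the component of $\partial H^{(\varepsilon)}$ in $H^+$ and the component of $\partial H^{(\varepsilon')}$ in $H^-$, both of which meet $K$ (if $H$ supports $K$, one of them is $H$ itself, with distance $0$); then $w(K,H)=\varepsilon+\varepsilon'$. Equivalently, $w(K,H)=\max_{x\in K\cap H^+}d(x,H)+\max_{x\in K\cap H^-}d(x,H)$. *)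

theory Defs
  imports "HOL-Analysis.Analysis"
begin

text \<open>
  Hyperbolic \<open>n\<close>-space, \<open>n = CARD('n)\<close>, as the hyperboloid model: the upper sheet of
  \<open>\<langle>p, p\<rangle> = -1\<close> in \<open>\<real>\<^sup>n \<times> \<real>\<close>, where \<open>\<langle>p, q\<rangle>\<close> is the Lorentz form, with the geodesic
  distance given by \<open>cosh (dist p q) = - \<langle>p, q\<rangle>\<close>.
\<close>

definition lorentz :: "(real^'n) \<times> real \<Rightarrow> (real^'n) \<times> real \<Rightarrow> real" where
  "lorentz p q = fst p \<bullet> fst q - snd p * snd q"

lemma lorentz_commute: "lorentz p q = lorentz q p"
  by (simp add: lorentz_def inner_commute)

lemma lorentz_add_left: "lorentz (p + q) r = lorentz p r + lorentz q r"
  and lorentz_add_right: "lorentz r (p + q) = lorentz r p + lorentz r q"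
  and lorentz_diff_left: "lorentz (p - q) r = lorentz p r - lorentz q r"
  and lorentz_diff_right: "lorentz r (p - q) = lorentz r p - lorentz r q"
  and lorentz_minus_left: "lorentz (- p) r = - lorentz p r"
  and lorentz_minus_right: "lorentz r (- p) = - lorentz r p"
  and lorentz_scale_left: "lorentz (c *\<^sub>R p) r = c * lorentz p r"
  and lorentz_scale_right: "lorentz r (c *\<^sub>R p) = c * lorentz r p"
  by (simp_all add: lorentz_def algebra_simps)

lemmas lorentz_simps =
  lorentz_add_left lorentz_add_right lorentz_diff_left lorentz_diff_right
  lorentz_minus_left lorentz_minus_right lorentz_scale_left lorentz_scale_right

typedef 'n hyperbolic = "{p :: (real^'n) \<times> real. lorentz p p = -1 \<and> snd p > 0}"
  morphisms hvec Abs_hyperbolic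
  by (rule exI[of _ "(0, 1)"]) (simp add: lorentz_def)

lemma hvec_self [simp]: "lorentz (hvec p) (hvec p) = -1"
  and hvec_pos: "snd (hvec p) > 0"
  using hvec[of p] by auto

lemma ortho_timelike_pos:
  assumes "lorentz q q < 0" "lorentz u q = 0"
  shows "lorentz u u \<ge> 0" and "lorentz u u = 0 \<Longrightarrow> u = 0"
proof -
  obtain x s where u: "u = (x, s)" by (cases u)
  obtain y t where q: "q = (y, t)" by (cases q)
  have y: "y \<bullet> y < t\<^sup>2" and st: "x \<bullet> y = s * t"
    using assms by (auto simp: u q lorentz_def power2_eq_square)
  have t: "t\<^sup>2 > 0"
    using y inner_ge_zero[of y] by linarith
  have cs: "s\<^sup>2 * t\<^sup>2 \<le> (x \<bullet> x) * (y \<bullet> y)"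
    using Cauchy_Schwarz_ineq[of x y] by (simp add: st power_mult_distrib)
  also have le: "\<dots> \<le> (x \<bullet> x) * t\<^sup>2"
    using y by (intro mult_left_mono) auto
  finally have "s\<^sup>2 \<le> x \<bullet> x"
    using t by simp
  then show "lorentz u u \<ge> 0"
    by (simp add: u lorentz_def power2_eq_square)
  assume "lorentz u u = 0"
  then have e: "x \<bullet> x = s\<^sup>2" by (simp add: u lorentz_def power2_eq_square)
  have "x = 0"
  proof (rule ccontr)
    assume "x \<noteq> 0"
    then have "(x \<bullet> x) * (y \<bullet> y) < (x \<bullet> x) * t\<^sup>2"
      using y by (intro mult_strict_left_mono) auto
    then show False using cs e by simp
  qed
  then show "u = 0" using e by (simp add: u zero_prod_def)
qed

lemma ortho_timelike_Cauchy_Schwarz: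
  assumes "lorentz q q < 0" "lorentz u q = 0" "lorentz w q = 0"
  shows "\<bar>lorentz u w\<bar> \<le> sqrt (lorentz u u) * sqrt (lorentz w w)"
proof (cases "lorentz w w = 0")
  case True
  then have "w = 0" using ortho_timelike_pos[OF assms(1,3)] by simp
  then show ?thesis by (simp add: lorentz_def)
next
  case False
  let ?a = "lorentz u u" and ?b = "lorentz u w" and ?c = "lorentz w w"
  have c: "?c > 0" using False ortho_timelike_pos(1)[OF assms(1,3)] by simp
  have "lorentz (?c *\<^sub>R u - ?b *\<^sub>R w) q = 0"
    using assms by (simp add: lorentz_simps)
  from ortho_timelike_pos(1)[OF assms(1) this]
  have "0 \<le> ?c * (?a * ?c - ?b\<^sup>2)"
    by (simp add: lorentz_simps lorentz_commute[of w u] algebra_simps power2_eq_square)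
  then have "?b\<^sup>2 \<le> ?a * ?c"
    using c by (simp add: zero_le_mult_iff)
  then have "sqrt (?b\<^sup>2) \<le> sqrt (?a * ?c)"
    by (rule real_sqrt_le_mono)
  then show ?thesis by (simp add: real_sqrt_mult)
qed

lemma lorentz_le_minus_one: "lorentz (hvec p) (hvec q) \<le> -1"
  and lorentz_eq_minus_one: "lorentz (hvec p) (hvec q) = -1 \<Longrightarrow> p = q"
proof -
  let ?C = "- lorentz (hvec p) (hvec q)"
  let ?u = "hvec p - ?C *\<^sub>R hvec q"
  have u: "lorentz ?u (hvec q) = 0" by (simp add: lorentz_simps)
  have uu: "lorentz ?u ?u = ?C\<^sup>2 - 1"
    by (simp add: lorentz_simps lorentz_commute[of "hvec q" "hvec p"] power2_eq_square)
  have "lorentz (hvec q) (hvec q) < 0" by simp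
  note pos = ortho_timelike_pos[OF this u]
  have "?C\<^sup>2 \<ge> 1" using pos(1) unfolding uu by simp
  then have C: "\<bar>?C\<bar> \<ge> 1" using abs_le_square_iff[of 1 ?C] by simp
  obtain x s where p: "hvec p = (x, s)" by (cases "hvec p")
  obtain y t where q: "hvec q = (y, t)" by (cases "hvec q")
  have "s > 0" "t > 0" "x \<bullet> x = s\<^sup>2 - 1" "y \<bullet> y = t\<^sup>2 - 1"
    using hvec_pos[of p] hvec_pos[of q] hvec_self[of p] hvec_self[of q]
    by (auto simp: p q lorentz_def power2_eq_square simp del: hvec_self)
  then have "norm x < s" "norm y < t"
    by (auto simp: norm_eq_sqrt_inner intro: real_less_lsqrt)
  then have "norm x * norm y < s * t"
    by (intro mult_strict_mono') auto
  then have "x \<bullet> y < s * t"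
    using norm_cauchy_schwarz[of x y] by linarith
  then have "?C > 0" by (simp add: p q lorentz_def)
  with C show "lorentz (hvec p) (hvec q) \<le> -1" by linarith
  assume "lorentz (hvec p) (hvec q) = -1"
  then have "?u = 0" using pos(2) unfolding uu by simp
  then show "p = q" using \<open>lorentz (hvec p) (hvec q) = -1\<close> by (simp add: hvec_inject)
qed

instantiation hyperbolic :: (finite) metric_space
begin

definition dist_hyperbolic :: "'a hyperbolic \<Rightarrow> 'a hyperbolic \<Rightarrow> real" where
  "dist p q = arcosh (- lorentz (hvec p) (hvec q))"

definition uniformity_hyperbolic :: "('a hyperbolic \<times> 'a hyperbolic) filter" where
  "uniformity_hyperbolic = (INF e\<in>{0<..}. principal {(x, y). dist x y < e})"

definition open_hyperbolic :: "'a hyperbolic set \<Rightarrow> bool" where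
  "open_hyperbolic U \<longleftrightarrow> (\<forall>x\<in>U. eventually (\<lambda>(x', y). x' = x \<longrightarrow> y \<in> U) uniformity)"

instance
proof
  fix p q r :: "'a hyperbolic"
  have *: "- lorentz (hvec p) (hvec q) \<ge> 1" for p q :: "'a hyperbolic"
    using lorentz_le_minus_one[of p q] by simp
  show "dist p q = 0 \<longleftrightarrow> p = q"
    using lorentz_eq_minus_one[of p q] *[of p q] by (auto simp: dist_hyperbolic_def)
  let ?C = "- lorentz (hvec p) (hvec r)" and ?D = "- lorentz (hvec q) (hvec r)"
  let ?u = "hvec p - ?C *\<^sub>R hvec r" and ?w = "hvec q - ?D *\<^sub>R hvec r"
  have u: "lorentz ?u (hvec r) = 0" "lorentz ?w (hvec r) = 0" by (simp_all add: lorentz_simps)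
  have uu: "lorentz ?u ?u = ?C\<^sup>2 - 1" "lorentz ?w ?w = ?D\<^sup>2 - 1"
    by (simp_all add: lorentz_simps lorentz_commute[of "hvec r" "hvec p"] lorentz_commute[of "hvec r" "hvec q"] power2_eq_square)
  have uw: "lorentz ?u ?w = lorentz (hvec p) (hvec q) + ?C * ?D"
    by (simp add: lorentz_simps lorentz_commute[of "hvec r" "hvec p"] lorentz_commute[of "hvec r" "hvec q"] algebra_simps)
  have "\<bar>lorentz ?u ?w\<bar> \<le> sqrt (?C\<^sup>2 - 1) * sqrt (?D\<^sup>2 - 1)"
    using ortho_timelike_Cauchy_Schwarz[OF _ u] unfolding uu by simp
  then have "- lorentz (hvec p) (hvec q) \<le> ?C * ?D + sqrt (?C\<^sup>2 - 1) * sqrt (?D\<^sup>2 - 1)"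
    unfolding uw by linarith
  also have "\<dots> = cosh (dist p r + dist q r)"
    unfolding cosh_add dist_hyperbolic_def
    by (simp only: cosh_arcosh_real[OF *] sinh_arcosh_real[OF *])
  finally have "cosh (dist p q) \<le> cosh (dist p r + dist q r)"
    by (simp only: dist_hyperbolic_def cosh_arcosh_real[OF *])
  then show "dist p q \<le> dist p r + dist q r"
    unfolding dist_hyperbolic_def
    by (subst (asm) cosh_real_nonneg_le_iff) (intro add_nonneg_nonneg arcosh_nonneg_real *)+
qed (fact uniformity_hyperbolic_def open_hyperbolic_def)+

end

lemma cosh_dist: "cosh (dist p q) = - lorentz (hvec p) (hvec q)"
  using lorentz_le_minus_one[of p q] by (simp add: dist_hyperbolic_def)

text \<open>
  Hyperbolic space is uniquely geodesic, and its geodesic segments are the metric intervals.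
\<close>

definition geodesic_segment :: "'n::finite hyperbolic \<Rightarrow> 'n hyperbolic \<Rightarrow> 'n hyperbolic set" where
  "geodesic_segment p q = {z. dist p z + dist z q = dist p q}"

definition geodesically_convex :: "'n::finite hyperbolic set \<Rightarrow> bool" where
  "geodesically_convex K \<longleftrightarrow> (\<forall>p\<in>K. \<forall>q\<in>K. geodesic_segment p q \<subseteq> K)"

definition convex_body :: "'n::finite hyperbolic set \<Rightarrow> bool" where
  "convex_body K \<longleftrightarrow> compact K \<and> geodesically_convex K \<and> interior K \<noteq> {}"

text \<open>
  Hyperplanes are the intersections of the hyperboloid with the Lorentz-orthogonal complements
  of spacelike vectors \<open>v\<close>; the two closed half-spaces bounded by such a hyperplane are given by
  the sign of \<open>\<langle>p, v\<rangle>\<close>, and replacing \<open>v\<close> by \<open>- v\<close> swaps them.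
\<close>

definition hyperplane_halfspaces ::
    "'n::finite hyperbolic set \<Rightarrow> 'n hyperbolic set \<Rightarrow> 'n hyperbolic set \<Rightarrow> bool" where
  "hyperplane_halfspaces H Hp Hm \<longleftrightarrow>
     (\<exists>v. lorentz v v > 0 \<and> H = {p. lorentz (hvec p) v = 0} \<and>
        Hp = {p. lorentz (hvec p) v \<ge> 0} \<and> Hm = {p. lorentz (hvec p) v \<le> 0})"

definition hyperplane :: "'n::finite hyperbolic set \<Rightarrow> bool" where
  "hyperplane H \<longleftrightarrow> (\<exists>v. lorentz v v > 0 \<and> H = {p. lorentz (hvec p) v = 0})"

definition tube :: "'n::finite hyperbolic set \<Rightarrow> real \<Rightarrow> 'n hyperbolic set" where
  "tube H e = {p. infdist p H \<le> e}"

text \<open>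
  The closed domain bounded by the part of the boundary of \<open>tube H e\<close> in \<open>Hp\<close> and the part of
  the boundary of \<open>tube H e'\<close> in \<open>Hm\<close> is \<open>tube H e \<inter> Hp \<union> tube H e' \<inter> Hm\<close>.  It supports \<open>K\<close>
  if it contains \<open>K\<close> and both boundary parts meet \<open>K\<close>.
\<close>

definition supporting_domain ::
    "'n::finite hyperbolic set \<Rightarrow> 'n hyperbolic set \<Rightarrow> real \<Rightarrow> real \<Rightarrow> bool" where
  "supporting_domain K H e e' \<longleftrightarrow>
     (\<exists>Hp Hm. hyperplane_halfspaces H Hp Hm \<and>
        K \<subseteq> tube H e \<inter> Hp \<union> tube H e' \<inter> Hm \<and>
        frontier (tube H e) \<inter> Hp \<inter> K \<noteq> {} \<and> frontier (tube H e') \<inter> Hm \<inter> K \<noteq> {})"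

definition width :: "'n::finite hyperbolic set \<Rightarrow> 'n hyperbolic set \<Rightarrow> real" where
  "width K H = (THE w. \<exists>e e'. supporting_domain K H e e' \<and> w = e + e')"

lemma hvec_ex:
  assumes "lorentz w w = -1" "lorentz w (hvec p) < 0"
  obtains q where "hvec q = w"
proof -
  obtain x s where w: "w = (x, s)" by (cases w)
  obtain y t where p: "hvec p = (y, t)" by (cases "hvec p")
  have xs: "x \<bullet> x < s\<^sup>2" and yt: "y \<bullet> y < t\<^sup>2" and t: "t > 0"
    using assms hvec_self[of p] hvec_pos[of p]
    by (auto simp: w p lorentz_def power2_eq_square simp del: hvec_self)
  have neg: "x \<bullet> y < s * t" using assms by (simp add: w p lorentz_def)
  have "snd w > 0"
  proof (rule ccontr)
    assume "\<not> snd w > 0"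
    then have s: "s \<le> 0" by (simp add: w)
    have "norm x \<le> - s" using xs s
      by (simp add: norm_eq_sqrt_inner real_le_lsqrt)
    moreover have "norm y \<le> t" using yt t
      by (simp add: norm_eq_sqrt_inner real_le_lsqrt)
    ultimately have "norm x * norm y \<le> (- s) * t"
      using s by (intro mult_mono) auto
    then show False using neg Cauchy_Schwarz_ineq2[of x y] by linarith
  qed
  then show thesis
    using that[of "Abs_hyperbolic w"] assms by (simp add: Abs_hyperbolic_inverse)
qed

lemma geodesic_point:
  fixes p :: "'n::finite hyperbolic"
  assumes "lorentz u (hvec p) = 0" "lorentz u u = 1"
  obtains q where "hvec q = cosh t *\<^sub>R hvec p + sinh t *\<^sub>R u" "dist p q = \<bar>t\<bar>"
proof -
  let ?w = "cosh t *\<^sub>R hvec p + sinh t *\<^sub>R u"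
  have a: "lorentz ?w ?w = -1"
    using assms cosh_square_eq[of t]
    by (simp add: lorentz_simps lorentz_commute[of "hvec p" u] power2_eq_square)
  have b: "lorentz ?w (hvec p) = - cosh t" using assms by (simp add: lorentz_simps)
  obtain q where q: "hvec q = ?w" using hvec_ex[OF a, of p] b by auto
  moreover have "dist p q = \<bar>t\<bar>"
    using b arcosh_cosh_real[of "\<bar>t\<bar>"] unfolding dist_hyperbolic_def q
    by (simp add: lorentz_commute[of "hvec p"] del: arcosh_cosh_real)
  ultimately show thesis using that by blast
qed

lemma lorentz_hvec_continuous: "continuous_on UNIV (\<lambda>p :: 'n::finite hyperbolic. lorentz (hvec p) v)"
proof -
  have bound: "\<bar>lorentz (hvec q) v - lorentz (hvec p) v\<bar> \<le>
      (cosh (dist p q) - 1) * \<bar>lorentz (hvec p) v\<bar> +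
      sinh (dist p q) * sqrt (lorentz v v + (lorentz (hvec p) v)\<^sup>2)" for p q :: "'n hyperbolic"
  proof -
    let ?C = "cosh (dist p q)" and ?a = "lorentz (hvec p) v"
    let ?u = "hvec q - ?C *\<^sub>R hvec p" and ?w = "v + ?a *\<^sub>R hvec p"
    have C: "lorentz (hvec q) (hvec p) = - ?C" "lorentz (hvec p) (hvec q) = - ?C"
      by (simp_all add: cosh_dist lorentz_commute)
    have u: "lorentz ?u (hvec p) = 0" "lorentz ?w (hvec p) = 0"
      by (simp_all add: lorentz_simps C lorentz_commute[of v "hvec p"])
    have uu: "lorentz ?u ?u = (sinh (dist p q))\<^sup>2"
      using cosh_square_eq[of "dist p q"] by (simp add: lorentz_simps C power2_eq_square)
    have ww: "lorentz ?w ?w = lorentz v v + ?a\<^sup>2"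
      by (simp add: lorentz_simps lorentz_commute[of v "hvec p"] power2_eq_square)
    have uw: "lorentz ?u ?w = lorentz (hvec q) v - ?C * ?a"
      using u(1) by (simp add: lorentz_simps C)
    have "\<bar>lorentz (hvec q) v - ?C * ?a\<bar> \<le> sinh (dist p q) * sqrt (lorentz v v + ?a\<^sup>2)"
      using ortho_timelike_Cauchy_Schwarz[OF _ u] unfolding uu ww uw by simp
    moreover have "?C * ?a - ?a = (?C - 1) * ?a"
      by (simp add: left_diff_distrib)
    then have "\<bar>?C * ?a - ?a\<bar> = (?C - 1) * \<bar>?a\<bar>"
      using cosh_real_ge_1[of "dist p q"] by (simp only: abs_mult abs_of_nonneg diff_ge_0_iff_ge)
    ultimately show ?thesis by linarith
  qed
  show ?thesis
    unfolding continuous_on_def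
  proof
    fix p :: "'n hyperbolic"
    let ?a = "lorentz (hvec p) v"
    have d: "((\<lambda>q. dist p q) \<longlongrightarrow> 0) (at p within UNIV)"
      using tendsto_dist[OF tendsto_const tendsto_ident_at, of p p UNIV] by simp
    have "((\<lambda>q. (cosh (dist p q) - 1) * \<bar>?a\<bar> +
        sinh (dist p q) * sqrt (lorentz v v + ?a\<^sup>2)) \<longlongrightarrow>
        (cosh 0 - 1) * \<bar>?a\<bar> + sinh 0 * sqrt (lorentz v v + ?a\<^sup>2)) (at p within UNIV)"
      by (intro tendsto_intros d)
    then have lim: "((\<lambda>q. (cosh (dist p q) - 1) * \<bar>?a\<bar> +
        sinh (dist p q) * sqrt (lorentz v v + ?a\<^sup>2)) \<longlongrightarrow> 0) (at p within UNIV)"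
      by (simp only: cosh_0 sinh_0 diff_self mult_zero_left add_0_left)
    have "((\<lambda>q. lorentz (hvec q) v - ?a) \<longlongrightarrow> 0) (at p within UNIV)"
    proof (rule Lim_null_comparison[OF always_eventually lim], rule allI)
      fix q
      show "norm (lorentz (hvec q) v - ?a) \<le> (cosh (dist p q) - 1) * \<bar>?a\<bar> +
          sinh (dist p q) * sqrt (lorentz v v + ?a\<^sup>2)"
        unfolding real_norm_def by (rule bound)
    qed
    then show "((\<lambda>q. lorentz (hvec q) v) \<longlongrightarrow> ?a) (at p within UNIV)"
      by (rule LIM_zero_cancel)
  qed
qed

lemma hyperplane_projection:
  assumes v: "lorentz v v = 1"
  obtains q where "lorentz (hvec q) v = 0" "dist p q = arsinh \<bar>lorentz (hvec p) v\<bar>"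
proof -
  let ?a = "lorentz (hvec p) v"
  define c where "c = sqrt (?a\<^sup>2 + 1)"
  have c: "c > 0" "c * c = ?a\<^sup>2 + 1"
    by (simp_all add: c_def add_nonneg_pos)
  let ?z = "hvec p - ?a *\<^sub>R v"
  let ?w = "(1 / c) *\<^sub>R ?z"
  have z: "lorentz ?z ?z = - (c * c)" "lorentz ?z (hvec p) = - (c * c)"
    unfolding c(2) by (simp_all add: lorentz_simps v lorentz_commute[of v "hvec p"] power2_eq_square)
  have a: "lorentz ?w ?w = -1" and b: "lorentz ?w (hvec p) = - c"
    unfolding lorentz_scale_left lorentz_scale_right z using c(1) by simp_all
  obtain q where q: "hvec q = ?w" using hvec_ex[OF a, of p] b c by auto
  have qv: "lorentz (hvec q) v = 0" by (simp add: q lorentz_simps v)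
  have "cosh (dist p q) = cosh (arsinh \<bar>?a\<bar>)"
    using b unfolding cosh_dist q lorentz_commute[of "hvec p" ?w] by (simp add: cosh_arsinh_real c_def)
  moreover have "arsinh \<bar>?a\<bar> \<ge> 0"
    using arsinh_real_neg_iff[of "\<bar>?a\<bar>"] by linarith
  ultimately have "dist p q = arsinh \<bar>?a\<bar>"
    using arcosh_cosh_real[of "dist p q"] arcosh_cosh_real[of "arsinh \<bar>?a\<bar>"] by simp
  then show thesis using that qv by blast
qed

lemma infdist_hyperplane:
  assumes v: "lorentz v v = 1"
  shows "infdist p {p. lorentz (hvec p) v = 0} = arsinh \<bar>lorentz (hvec p) v\<bar>"
proof -
  let ?a = "lorentz (hvec p) v" and ?H = "{p. lorentz (hvec p) v = 0}"
  obtain q where q: "q \<in> ?H" "dist p q = arsinh \<bar>?a\<bar>"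
    using hyperplane_projection[OF v, of p] by auto
  have "arsinh \<bar>?a\<bar> \<le> dist p h" if "h \<in> ?H" for h
  proof -
    have h: "lorentz (hvec h) v = 0" "lorentz v (hvec h) = 0"
      using that by (simp_all add: lorentz_commute)
    let ?C = "cosh (dist p h)"
    let ?u = "hvec p - ?C *\<^sub>R hvec h"
    have C: "lorentz (hvec p) (hvec h) = - ?C" "lorentz (hvec h) (hvec p) = - ?C"
      by (simp_all add: cosh_dist lorentz_commute)
    have u: "lorentz ?u (hvec h) = 0" by (simp add: lorentz_simps C)
    have uu: "lorentz ?u ?u = (sinh (dist p h))\<^sup>2"
      using cosh_square_eq[of "dist p h"] by (simp add: lorentz_simps C power2_eq_square)
    have "\<bar>lorentz ?u v\<bar> \<le> sinh (dist p h)"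
      using ortho_timelike_Cauchy_Schwarz[OF _ u h(2)] unfolding uu by (simp add: v)
    then have "sinh (arsinh \<bar>?a\<bar>) \<le> sinh (dist p h)"
      by (simp add: lorentz_simps h)
    then show ?thesis by (simp only: sinh_real_le_iff)
  qed
  then have "arsinh \<bar>?a\<bar> \<le> infdist p ?H"
    using q by (subst infdist_notempty) (auto intro!: cINF_greatest)
  moreover have "infdist p ?H \<le> arsinh \<bar>?a\<bar>"
    using infdist_le[OF q(1), of p] q(2) by simp
  ultimately show ?thesis by simp
qed

lemma unit_normal:
  assumes "hyperplane_halfspaces H Hp Hm"
  obtains v where "lorentz v v = 1" "H = {p. lorentz (hvec p) v = 0}"
    "Hp = {p. lorentz (hvec p) v \<ge> 0}" "Hm = {p. lorentz (hvec p) v \<le> 0}"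
proof -
  obtain v where v: "lorentz v v > 0" "H = {p. lorentz (hvec p) v = 0}"
    "Hp = {p. lorentz (hvec p) v \<ge> 0}" "Hm = {p. lorentz (hvec p) v \<le> 0}"
    using assms unfolding hyperplane_halfspaces_def by auto
  let ?c = "1 / sqrt (lorentz v v)"
  show thesis
    by (rule that[of "?c *\<^sub>R v"])
       (use v in \<open>auto simp: lorentz_simps zero_le_mult_iff mult_le_0_iff zero_le_divide_iff divide_le_0_iff\<close>)
qed

lemma halfspaces_unique:
  fixes H :: "'n::finite hyperbolic set"
  assumes "hyperplane_halfspaces H Hp Hm" "hyperplane_halfspaces H Hp' Hm'"
  shows "Hp' = Hp \<and> Hm' = Hm \<or> Hp' = Hm \<and> Hm' = Hp"
proof -
  obtain v where v: "lorentz v v = 1" "H = {p. lorentz (hvec p) v = 0}"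
    "Hp = {p. lorentz (hvec p) v \<ge> 0}" "Hm = {p. lorentz (hvec p) v \<le> 0}"
    using unit_normal[OF assms(1)] .
  obtain v' where v': "lorentz v' v' = 1" "H = {p. lorentz (hvec p) v' = 0}"
    "Hp' = {p. lorentz (hvec p) v' \<ge> 0}" "Hm' = {p. lorentz (hvec p) v' \<le> 0}"
    using unit_normal[OF assms(2)] .
  let ?k = "lorentz v' v"
  let ?u = "v' - ?k *\<^sub>R v"
  obtain p where p: "lorentz (hvec p) v = 0"
    using hyperplane_projection[OF v(1)] by blast
  then have p': "lorentz (hvec p) v' = 0" using v(2) v'(2) by blast
  have up: "lorentz ?u (hvec p) = 0"
    using p p' by (simp add: lorentz_simps lorentz_commute[of _ "hvec p"])
  have uv: "lorentz ?u v = 0" "lorentz ?u v' = lorentz ?u ?u"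
    by (simp_all add: lorentz_simps v lorentz_commute[of v v'])
  have "?u = 0"
  proof (rule ccontr)
    assume "?u \<noteq> 0"
    then have pos: "lorentz ?u ?u > 0"
      using ortho_timelike_pos[OF _ up] by fastforce
    let ?e = "(1 / sqrt (lorentz ?u ?u)) *\<^sub>R ?u"
    have e: "lorentz ?e (hvec p) = 0" "lorentz ?e ?e = 1"
      using up pos by (simp_all only: lorentz_scale_left lorentz_scale_right) auto
    obtain q where q: "hvec q = cosh 1 *\<^sub>R hvec p + sinh 1 *\<^sub>R ?e"
      using geodesic_point[OF e] by blast
    have "lorentz (hvec q) v = 0"
      unfolding q lorentz_add_left lorentz_scale_left uv p by simp
    then have "lorentz (hvec q) v' = 0" using v(2) v'(2) by blast
    then show False
      using pos unfolding q lorentz_add_left lorentz_scale_left uv p' by simp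
  qed
  then have v'v: "v' = ?k *\<^sub>R v" by simp
  then have "lorentz v' v' = ?k\<^sup>2 * lorentz v v"
    by (metis lorentz_scale_left lorentz_scale_right mult.assoc power2_eq_square)
  then have "?k = 1 \<or> ?k = -1" using v v' by (simp add: power2_eq_1_iff)
  then have "v' = v \<or> v' = - v" using v'v by auto
  then show ?thesis
    using v v' by (auto simp: lorentz_simps)
qed

lemma frontier_tube:
  fixes H :: "'n::finite hyperbolic set"
  assumes H: "hyperplane_halfspaces H Hp Hm"
  shows "frontier (tube H e) = {p. infdist p H = e}"
proof
  have op: "open {p. infdist p H < e}"
    by (intro open_Collect_less continuous_intros)
  have cl: "closed (tube H e)"
    unfolding tube_def by (intro closed_Collect_le continuous_intros)
  have "{p. infdist p H < e} \<subseteq> interior (tube H e)"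
    by (intro interior_maximal op) (auto simp: tube_def)
  then have "frontier (tube H e) \<subseteq> tube H e - {p. infdist p H < e}"
    using cl unfolding frontier_def by (simp add: Diff_mono)
  also have "\<dots> = {p. infdist p H = e}"
    by (simp only: tube_def set_eq_iff Diff_iff mem_Collect_eq not_less) (simp add: eq_iff)
  finally show "frontier (tube H e) \<subseteq> {p. infdist p H = e}" .
  obtain v where v: "lorentz v v = 1" "H = {p. lorentz (hvec p) v = 0}"
    "Hp = {p. lorentz (hvec p) v \<ge> 0}" "Hm = {p. lorentz (hvec p) v \<le> 0}"
    using unit_normal[OF H] .
  show "{p. infdist p H = e} \<subseteq> frontier (tube H e)"
  proof
    fix p assume "p \<in> {p. infdist p H = e}"
    then have p: "infdist p H = e" by simp
    have "p \<notin> interior (tube H e)"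
    proof
      assume "p \<in> interior (tube H e)"
      then obtain d where d: "d > 0" "ball p d \<subseteq> tube H e"
        unfolding mem_interior by blast
      let ?a = "lorentz (hvec p) v"
      define s :: real where "s = (if ?a \<ge> 0 then 1 else -1)"
      have s: "s * ?a = \<bar>?a\<bar>" "s * s = 1" by (auto simp: s_def)
      let ?u = "v + ?a *\<^sub>R hvec p"
      define n where "n = sqrt (?a\<^sup>2 + 1)"
      have n: "n > 0" "?a\<^sup>2 + 1 = n * n" by (simp_all add: n_def add_nonneg_pos)
      let ?e = "(s / n) *\<^sub>R ?u"
      have uv: "lorentz ?u v = ?a\<^sup>2 + 1" "lorentz ?u ?u = ?a\<^sup>2 + 1" "lorentz ?u (hvec p) = 0"
        by (simp_all add: lorentz_simps v lorentz_commute[of v "hvec p"] power2_eq_square)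
      have e: "lorentz ?e (hvec p) = 0" "lorentz ?e ?e = 1"
        unfolding lorentz_scale_left lorentz_scale_right uv n using s(2) n(1)
        by simp_all
      have ev: "s * lorentz ?e v = n"
        unfolding lorentz_scale_left uv n using s(2) n(1) by simp
      obtain q where q: "hvec q = cosh (d/2) *\<^sub>R hvec p + sinh (d/2) *\<^sub>R ?e" "dist p q = d/2"
        using geodesic_point[OF e, of "d/2"] d by auto
      have "s * lorentz (hvec q) v = cosh (d/2) * (s * ?a) + sinh (d/2) * (s * lorentz ?e v)"
        unfolding q(1) lorentz_add_left lorentz_scale_left[of "cosh (d/2)"] lorentz_scale_left[of "sinh (d/2)"]
        by (simp only: distrib_left mult.left_commute)
      also have "\<dots> = cosh (d/2) * \<bar>?a\<bar> + sinh (d/2) * n"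
        unfolding ev s ..
      also have "\<dots> > \<bar>?a\<bar>"
      proof -
        have "cosh (d/2) * \<bar>?a\<bar> \<ge> 1 * \<bar>?a\<bar>"
          by (intro mult_right_mono cosh_real_ge_1) auto
        moreover have "sinh (d/2) * n > 0" using d n by simp
        ultimately show ?thesis by linarith
      qed
      finally have "\<bar>lorentz (hvec q) v\<bar> > \<bar>?a\<bar>"
        unfolding s_def by (auto split: if_splits)
      then have "infdist q H > e"
        unfolding p[symmetric] v(2) infdist_hyperplane[OF v(1)] by simp
      moreover have "q \<in> ball p d" using q d by simp
      ultimately show False using d by (force simp: tube_def)
    qed
    then show "p \<in> frontier (tube H e)"
      using p closure_subset[of "tube H e"] by (auto simp: frontier_def tube_def)
  qed
qed

text \<open>
  The supporting domain of a compact set meeting \<open>H\<close> exists and has uniquely determined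
  distances up to swapping, so the description in \<open>width\<close> is proper; the width is the sum of
  the maximal distances from \<open>H\<close> on its two sides.
\<close>

theorem width_eq:
  fixes K :: "'n::finite hyperbolic set"
  assumes K: "compact K" "H \<inter> K \<noteq> {}" and H: "hyperplane_halfspaces H Hp Hm"
  shows "width K H = (SUP p\<in>K \<inter> Hp. infdist p H) + (SUP p\<in>K \<inter> Hm. infdist p H)"
    (is "_ = ?e + ?e'")
proof -
  obtain v where "lorentz v v = 1" and v: "H = {p. lorentz (hvec p) v = 0}"
    "Hp = {p. lorentz (hvec p) v \<ge> 0}" "Hm = {p. lorentz (hvec p) v \<le> 0}"
    using unit_normal[OF H] .
  have cl: "closed Hp" "closed Hm"
    unfolding v by (intro closed_Collect_le lorentz_hvec_continuous continuous_on_const)+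
  have Un: "Hp \<union> Hm = UNIV" "Hp \<inter> Hm = H" by (auto simp: v)
  have Max: "\<exists>p\<in>K \<inter> S. infdist p H = (SUP p\<in>K \<inter> S. infdist p H)"
      "p \<in> K \<Longrightarrow> p \<in> S \<Longrightarrow> infdist p H \<le> (SUP p\<in>K \<inter> S. infdist p H)"
    if "S \<in> {Hp, Hm}" for S p
  proof -
    have c: "compact (K \<inter> S)" using that K cl by (auto intro: compact_Int_closed)
    have ne: "K \<inter> S \<noteq> {}" using that K Un by auto
    have "continuous_on (K \<inter> S) (\<lambda>p. infdist p H)" by (intro continuous_intros)
    from continuous_attains_sup[OF c ne this] obtain m where
      m: "m \<in> K \<inter> S" "\<And>p. p \<in> K \<inter> S \<Longrightarrow> infdist p H \<le> infdist m H" by blast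
    have "(SUP p\<in>K \<inter> S. infdist p H) = infdist m H"
      using m by (intro cSup_eq_maximum) auto
    then show "\<exists>p\<in>K \<inter> S. infdist p H = (SUP p\<in>K \<inter> S. infdist p H)"
      "p \<in> K \<Longrightarrow> p \<in> S \<Longrightarrow> infdist p H \<le> (SUP p\<in>K \<inter> S. infdist p H)"
      using m by auto
  qed
  note MaxE = Max(1)[of Hp, simplified] Max(1)[of Hm, simplified]
  have supp: "supporting_domain K H ?e ?e'"
    unfolding supporting_domain_def
  proof (rule exI[of _ Hp], rule exI[of _ Hm], intro conjI H)
    show "K \<subseteq> tube H ?e \<inter> Hp \<union> tube H ?e' \<inter> Hm"
    proof
      fix x assume "x \<in> K"
      then show "x \<in> tube H ?e \<inter> Hp \<union> tube H ?e' \<inter> Hm"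
        using Max(2)[of Hp x] Max(2)[of Hm x] Un(1) by (auto simp: tube_def)
    qed
    show "frontier (tube H ?e) \<inter> Hp \<inter> K \<noteq> {}" "frontier (tube H ?e') \<inter> Hm \<inter> K \<noteq> {}"
      unfolding frontier_tube[OF H] using MaxE by blast+
  qed
  have sup: "e = (SUP p\<in>K \<inter> A. infdist p H) \<and> e' = (SUP p\<in>K \<inter> B. infdist p H)"
    if AB: "A = Hp \<and> B = Hm \<or> A = Hm \<and> B = Hp" and sub: "K \<subseteq> tube H e \<inter> A \<union> tube H e' \<inter> B"
      and fr: "frontier (tube H e) \<inter> A \<inter> K \<noteq> {}" "frontier (tube H e') \<inter> B \<inter> K \<noteq> {}"
    for A B e e'
  proof -
    obtain p q where p: "p \<in> A" "p \<in> K" "infdist p H = e" and q: "q \<in> B" "q \<in> K" "infdist q H = e'"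
      using fr unfolding frontier_tube[OF H] by blast
    have nn: "e \<ge> 0" "e' \<ge> 0" using p q infdist_nonneg by blast+
    have AB': "A \<inter> B = H" using AB Un by auto
    have "infdist x H \<le> e" if x: "x \<in> K" "x \<in> A" for x
      using x sub AB' nn by (cases "x \<in> B") (auto simp: tube_def)
    moreover have "infdist x H \<le> e'" if x: "x \<in> K" "x \<in> B" for x
      using x sub AB' nn by (cases "x \<in> A") (auto simp: tube_def)
    ultimately show ?thesis
      using p q by (auto intro!: cSup_eq_maximum[symmetric])
  qed
  show ?thesis
    unfolding width_def
  proof (rule the_equality)
    show "\<exists>e e'. supporting_domain K H e e' \<and> ?e + ?e' = e + e'"
      using supp by blast
    fix w assume "\<exists>e e'. supporting_domain K H e e' \<and> w = e + e'"
    then obtain e e' A B where w: "w = e + e'" "hyperplane_halfspaces H A B"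
      "K \<subseteq> tube H e \<inter> A \<union> tube H e' \<inter> B"
      "frontier (tube H e) \<inter> A \<inter> K \<noteq> {}" "frontier (tube H e') \<inter> B \<inter> K \<noteq> {}"
      unfolding supporting_domain_def by blast
    have "A = Hp \<and> B = Hm \<or> A = Hm \<and> B = Hp" using halfspaces_unique[OF H w(2)] .
    then show "w = ?e + ?e'"
      using sup[OF _ w(3-5)] w(1) by auto
  qed
qed

end

theory Submission
  imports Defs
begin

text \<open>
  For a unit normal \<open>v\<close>, the signed distance of \<open>p\<close> from the hyperplane \<open>v\<^sup>\<bottom>\<close> is
  \<open>arsinh \<langle>p, v\<rangle>\<close>, and it is a 1-Lipschitz function of \<open>p\<close>
  (\<open>arsinh_lorentz_lipschitz\<close>).  If \<open>a\<close> and \<open>b\<close> are points of \<open>K\<close> on the two sides of a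
  hyperplane \<open>H\<close>, their signed distances have opposite signs, so the distances of \<open>a\<close> and \<open>b\<close>
  from \<open>H\<close> add up to at most \<open>dist a b\<close>; hence \<open>w(K, H) \<le> diam K\<close> (\<open>width_le_diameter\<close>).

  For equality, let \<open>dist p q = diam K\<close> with \<open>p, q \<in> K\<close>, and let \<open>H\<close> be the hyperplane through
  \<open>p\<close> orthogonal to the geodesic from \<open>p\<close> to \<open>q\<close>.  The point of \<open>H\<close> nearest to \<open>q\<close> is \<open>p\<close>, so
  already the side of \<open>H\<close> containing \<open>q\<close> contributes \<open>diam K\<close> to the width
  (\<open>orthogonal_hyperplane_through\<close>, \<open>infdist_le_width\<close>).
\<close>

text \<open>
  Write \<open>a = sinh s v + cosh s a'\<close> and \<open>b = sinh t v + cosh t b'\<close> with the feet \<open>a'\<close>, \<open>b'\<close> of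
  \<open>a\<close>, \<open>b\<close> in the hyperplane.  Since \<open>\<langle>a', b'\<rangle> \<le> -1\<close>, this gives
  \<open>cosh (dist a b) \<ge> cosh s cosh t - sinh s sinh t = cosh (s - t)\<close>.
\<close>

lemma arsinh_lorentz_lipschitz:
  fixes a b :: "'n::finite hyperbolic"
  assumes v: "lorentz v v = 1"
  shows "arsinh (lorentz (hvec a) v) - arsinh (lorentz (hvec b) v) \<le> dist a b"
proof -
  let ?x = "lorentz (hvec a) v" and ?y = "lorentz (hvec b) v"
  \<comment> \<open>Normalizing the component of \<open>p\<close> orthogonal to \<open>v\<close> gives its foot on the hyperplane.\<close>
  have foot: "\<exists>q. hvec p = lorentz (hvec p) v *\<^sub>R v + sqrt ((lorentz (hvec p) v)\<^sup>2 + 1) *\<^sub>R hvec q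
      \<and> lorentz (hvec q) v = 0" for p :: "'n hyperbolic"
  proof -
    let ?t = "lorentz (hvec p) v"
    define c where "c = sqrt (?t\<^sup>2 + 1)"
    have c: "c > 0" "c * c = ?t\<^sup>2 + 1"
      by (simp_all add: c_def add_nonneg_pos)
    let ?z = "hvec p - ?t *\<^sub>R v"
    let ?w = "(1 / c) *\<^sub>R ?z"
    have z: "lorentz ?z ?z = - (c * c)" "lorentz ?z (hvec p) = - (c * c)" "lorentz ?z v = 0"
      unfolding c(2)
      by (simp_all add: lorentz_simps v lorentz_commute[of v "hvec p"] power2_eq_square)
    have w: "lorentz ?w ?w = -1" "lorentz ?w (hvec p) = - c" "lorentz ?w v = 0"
      unfolding lorentz_scale_left lorentz_scale_right z using c(1) by simp_all
    obtain q where q: "hvec q = ?w"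
      using hvec_ex[OF w(1), of p] w(2) c(1) by auto
    then have "c *\<^sub>R hvec q = ?z" using c(1) by simp
    then have "hvec p = ?t *\<^sub>R v + c *\<^sub>R hvec q" by simp
    then show ?thesis using q w(3) unfolding c_def by metis
  qed
  let ?c = "sqrt (?x\<^sup>2 + 1)" and ?d = "sqrt (?y\<^sup>2 + 1)"
  obtain a' where a': "hvec a = ?x *\<^sub>R v + ?c *\<^sub>R hvec a'" "lorentz (hvec a') v = 0"
    using foot by blast
  obtain b' where b': "hvec b = ?y *\<^sub>R v + ?d *\<^sub>R hvec b'" "lorentz (hvec b') v = 0"
    using foot by blast
  have expand: "lorentz (x *\<^sub>R v + c *\<^sub>R y) (x' *\<^sub>R v + c' *\<^sub>R y') = x * x' + c * c' * lorentz y y'"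
    if "lorentz y v = 0" "lorentz y' v = 0" for x x' c c' y y'
    using that by (simp add: lorentz_simps v lorentz_commute[of v y'])
  have ab: "lorentz (hvec a) (hvec b) = ?x * ?y + ?c * ?d * lorentz (hvec a') (hvec b')"
    by (rule trans[OF arg_cong2[where f = lorentz, OF a'(1) b'(1)] expand[OF a'(2) b'(2)]])
  have "?c * ?d * lorentz (hvec a') (hvec b') \<le> ?c * ?d * (-1)"
    by (intro mult_left_mono lorentz_le_minus_one) simp
  then have "cosh (arsinh ?x - arsinh ?y) \<le> cosh (dist a b)"
    unfolding cosh_dist ab cosh_diff by (simp add: cosh_arsinh_real)
  then have "cosh \<bar>arsinh ?x - arsinh ?y\<bar> \<le> cosh (dist a b)"
    by simp
  then have "\<bar>arsinh ?x - arsinh ?y\<bar> \<le> dist a b"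
    by (subst (asm) cosh_real_nonneg_le_iff) auto
  then show ?thesis by linarith
qed

lemma infdist_add_infdist_le_dist:
  assumes H: "hyperplane_halfspaces H Hp Hm" and "a \<in> Hp" "b \<in> Hm"
  shows "infdist a H + infdist b H \<le> dist a b"
proof -
  obtain v where v: "lorentz v v = 1" "H = {p. lorentz (hvec p) v = 0}"
    "Hp = {p. lorentz (hvec p) v \<ge> 0}" "Hm = {p. lorentz (hvec p) v \<le> 0}"
    using unit_normal[OF H] .
  have "infdist a H = arsinh (lorentz (hvec a) v)" "infdist b H = - arsinh (lorentz (hvec b) v)"
    using assms(2,3) unfolding v(2) infdist_hyperplane[OF v(1)]
    by (auto simp: v abs_if)
  then show ?thesis
    using arsinh_lorentz_lipschitz[OF v(1), of a b] by linarith
qed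

lemma bdd_above_infdist:
  assumes "compact K"
  shows "bdd_above ((\<lambda>p. infdist p H) ` (K \<inter> S))"
proof -
  have "compact ((\<lambda>p. infdist p H) ` K)"
    by (intro compact_continuous_image continuous_intros assms)
  then have "bdd_above ((\<lambda>p. infdist p H) ` K)"
    by (intro bounded_imp_bdd_above compact_imp_bounded)
  then show ?thesis
    by (rule bdd_above_mono) (intro image_mono Int_lower1)
qed

lemma hyperplane_halfspaces_ex:
  assumes "hyperplane H"
  obtains Hp Hm where "hyperplane_halfspaces H Hp Hm" "Hp \<inter> Hm = H"
proof -
  obtain v where v: "lorentz v v > 0" "H = {p. lorentz (hvec p) v = 0}"
    using assms unfolding hyperplane_def by blast
  show thesis
    by (rule that[of "{p. lorentz (hvec p) v \<ge> 0}" "{p. lorentz (hvec p) v \<le> 0}"])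
       (use v in \<open>auto simp only: hyperplane_halfspaces_def intro!: exI[of _ v]\<close>)
qed

lemma width_le_diameter:
  assumes K: "compact K" "H \<inter> K \<noteq> {}" and H: "hyperplane H"
  shows "width K H \<le> diameter K"
proof -
  obtain Hp Hm where Hpm: "hyperplane_halfspaces H Hp Hm" "Hp \<inter> Hm = H"
    using hyperplane_halfspaces_ex[OF H] .
  have ne: "K \<inter> Hp \<noteq> {}" "K \<inter> Hm \<noteq> {}" using K(2) Hpm(2) by auto
  have le: "infdist a H + infdist b H \<le> diameter K" if "a \<in> K \<inter> Hp" "b \<in> K \<inter> Hm" for a b
    using infdist_add_infdist_le_dist[OF Hpm(1), of a b]
      diameter_bounded_bound[OF compact_imp_bounded[OF K(1)], of a b] that by auto
  have "(SUP b\<in>K \<inter> Hm. infdist b H) \<le> diameter K - infdist a H" if "a \<in> K \<inter> Hp" for a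
    using ne(2) le[OF that] by (intro cSUP_least) (auto simp: algebra_simps)
  then have "(SUP a\<in>K \<inter> Hp. infdist a H) \<le> diameter K - (SUP b\<in>K \<inter> Hm. infdist b H)"
    using ne(1) by (intro cSUP_least) (auto simp: algebra_simps)
  then show ?thesis
    unfolding width_eq[OF K Hpm(1)] by linarith
qed

lemma infdist_le_width:
  assumes K: "compact K" "H \<inter> K \<noteq> {}" and H: "hyperplane H" and q: "q \<in> K"
  shows "infdist q H \<le> width K H"
proof -
  obtain Hp Hm where Hpm: "hyperplane_halfspaces H Hp Hm" "Hp \<inter> Hm = H"
    using hyperplane_halfspaces_ex[OF H] .
  have un: "Hp \<union> Hm = UNIV"
    using Hpm(1) unfolding hyperplane_halfspaces_def by auto
  obtain p where p: "p \<in> K" "p \<in> Hp" "p \<in> Hm" using K(2) Hpm(2) by auto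
  have up: "infdist x H \<le> (SUP p\<in>K \<inter> S. infdist p H)" if "x \<in> K \<inter> S" for x S
    using that by (intro cSUP_upper bdd_above_infdist K)
  have "0 \<le> (SUP p\<in>K \<inter> S. infdist p H)" if "p \<in> K \<inter> S" for S
    using up[OF that] infdist_nonneg[of p H] by linarith
  then have "0 \<le> (SUP p\<in>K \<inter> Hp. infdist p H)" "0 \<le> (SUP p\<in>K \<inter> Hm. infdist p H)"
    using p by auto
  then show ?thesis
    using un q up[of q Hp] up[of q Hm] unfolding width_eq[OF K Hpm(1)] by fastforce
qed

text \<open>
  For \<open>p \<noteq> q\<close> the normal is the initial unit tangent vector of the geodesic from \<open>p\<close> to \<open>q\<close>;
  for \<open>p = q\<close> any hyperplane through \<open>p\<close> will do.
\<close>

lemma orthogonal_hyperplane_through: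
  fixes p q :: "'n::finite hyperbolic"
  obtains H where "hyperplane H" "p \<in> H" "infdist q H = dist p q"
proof (cases "p = q")
  case True
  obtain x s where p: "hvec p = (x, s)" by (cases "hvec p")
  have xs: "x \<bullet> x < s\<^sup>2"
    using hvec_self[of p] by (simp add: p lorentz_def power2_eq_square del: hvec_self)
  obtain e :: "real^'n" where e: "norm e = 1"
    using vector_choose_size[of 1] by auto
  \<comment> \<open>The vector orthogonal to \<open>p\<close> in the plane spanned by \<open>(e, 0)\<close> and \<open>(0, 1)\<close>.\<close>
  let ?v = "(s *\<^sub>R e, x \<bullet> e)"
  have "(x \<bullet> e)\<^sup>2 \<le> x \<bullet> x"
    using Cauchy_Schwarz_ineq[of x e] e by (simp add: norm_eq_1)
  then have "lorentz ?v ?v > 0"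
    using xs e by (simp add: lorentz_def norm_eq_1 power2_eq_square)
  moreover have "lorentz (hvec p) ?v = 0"
    by (simp add: p lorentz_def)
  ultimately show thesis
    using True by (intro that[of "{p. lorentz (hvec p) ?v = 0}"]) (auto simp: hyperplane_def)
next
  case False
  let ?d = "dist p q"
  have d: "?d > 0" "sinh ?d > 0" using False by auto
  let ?u = "hvec q - cosh ?d *\<^sub>R hvec p"
  let ?v = "(1 / sinh ?d) *\<^sub>R ?u"
  have C: "lorentz (hvec p) (hvec q) = - cosh ?d" "lorentz (hvec q) (hvec p) = - cosh ?d"
    by (simp_all add: cosh_dist lorentz_commute)
  have u: "lorentz ?u ?u = (sinh ?d)\<^sup>2" "lorentz (hvec p) ?u = 0"
      "lorentz (hvec q) ?u = (sinh ?d)\<^sup>2"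
    using cosh_square_eq[of ?d] by (simp_all add: lorentz_simps C power2_eq_square)
  have v: "lorentz ?v ?v = 1" "lorentz (hvec p) ?v = 0" "lorentz (hvec q) ?v = sinh ?d"
    unfolding lorentz_scale_left lorentz_scale_right u using d(2)
    by (simp_all add: power2_eq_square)
  have "infdist q {p. lorentz (hvec p) ?v = 0} = ?d"
    unfolding infdist_hyperplane[OF v(1)] v(3) using d by (simp add: arsinh_sinh_real)
  then show thesis
    using v by (intro that[of "{p. lorentz (hvec p) ?v = 0}"])
      (auto simp only: hyperplane_def mem_Collect_eq zero_less_one intro!: exI[of _ ?v])
qed

theorem lemma6p4:
  fixes K :: "'n::finite hyperbolic set"
  assumes "CARD('n) \<ge> 2"
    and "convex_body K"
  shows "diameter K \<in> {width K H | H. hyperplane H \<and> H \<inter> K \<noteq> {}} \<and>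
    (\<forall>w \<in> {width K H | H. hyperplane H \<and> H \<inter> K \<noteq> {}}. w \<le> diameter K)"
proof -
  have K: "compact K" "K \<noteq> {}"
    using assms(2) interior_subset[of K] unfolding convex_body_def by auto
  obtain p q where pq: "p \<in> K" "q \<in> K" "dist p q = diameter K"
    using diameter_compact_attained[OF K] by blast
  obtain H where H: "hyperplane H" "p \<in> H" "infdist q H = dist p q"
    using orthogonal_hyperplane_through .
  have HK: "H \<inter> K \<noteq> {}" using H(2) pq(1) by blast
  have w: "width K H = diameter K"
    using width_le_diameter[OF K(1) HK H(1)] infdist_le_width[OF K(1) HK H(1) pq(2)] H(3) pq(3)
    by simp
  show ?thesis
  proof (intro conjI ballI)
    show "diameter K \<in> {width K H | H. hyperplane H \<and> H \<inter> K \<noteq> {}}"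
      by (rule CollectI, rule exI[of _ H]) (simp add: w H(1) HK)
  next
    fix w assume "w \<in> {width K H | H. hyperplane H \<and> H \<inter> K \<noteq> {}}"
    then obtain H' where "w = width K H'" "hyperplane H'" "H' \<inter> K \<noteq> {}"
      by (elim CollectE exE conjE)
    then show "w \<le> diameter K"
      using width_le_diameter[OF K(1)] by simp
  qed
qed

end
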